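(* (Martinet flat sub-Riemannian structure.) On $\mathbb R^3$ with coordinates $(x,y,z)$, let $a,\mathsf z,V,\pi,L,\Gamma_1,\Gamma_1^z,\Gamma_2,\Gamma_2^{z,\pi},Q,P,X$ be as in the context. For every smooth $f$, $$\Gamma_2(f,f)+\Gamma_2^{z,\pi}(f,f)=\|\mathfrak{Hess}_{a,z}f\|^2+\mathfrak R(\nabla f,\nabla f),$$ where $\|\mathfrak{Hess}_{a,z}f\|^2=[X+\Lambda_1]^{\mathsf T}Q^{\mathsf T}Q[X+\Lambda_1]+[X+\Lambda_2]^{\mathsf T}P^{\mathsf T}P[X+\Lambda_2]$ with $$\Lambda_1^{\mathsf T}=\big(0,\tfrac{y\partial_zf}2,0,\tfrac{y\partial_zf}2,0,0,0,0,0\big),\qquad\Lambda_2^{\mathsf T}=\big(0,0,0,0,0,0,-y\partial_yf,\tfrac{y^3}2\partial_zf+y\partial_xf,0\big),$$ and $\mathfrak R(\nabla f,\nabla f)=\mathfrak R_1+\mathfrak R_2$ with $$\begin{aligned}\mathfrak R_1=\;&\tfrac{y^2}2\Gamma_1^z(f,f)-y^2\Gamma_1(f,f)+\partial_zf\,(a^{\mathsf T}\nabla)_1f+y\,(a^{\mathsf T}\nabla)_1V\,\partial_zf\,(a^{\mathsf T}\nabla)_2f+yV_z\,(a^{\mathsf T}\nabla)_1f\,(a^{\mathsf T}\nabla)_2f\\&+\Big(V_{xx}+y^2V_{xz}+\tfrac{y^4}4V_{zz}\Big)|(a^{\mathsf T}\nabla)_1f|^2+2\Big(V_{xy}+\tfrac{y^2}2V_{yz}\Big)(a^{\mathsf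 T}\nabla)_1f\,(a^{\mathsf T}\nabla)_2f\\&+V_{yy}|(a^{\mathsf T}\nabla)_2f|^2-yV_y\,\partial_zf\,(a^{\mathsf T}\nabla)_1f,\end{aligned}$$ $$\mathfrak R_2=\Big(V_{xz}+\tfrac{y^2}2V_{zz}\Big)(a^{\mathsf T}\nabla)_1f\,\partial_zf+V_{yz}\,(a^{\mathsf T}\nabla)_2f\,\partial_zf .$$
   Context: Coordinates $(x_1,x_2,x_3)=(x,y,z)$ on $\mathbb R^3$. $a^{\mathsf T}=\begin{pmatrix}1&0&\frac{y^2}2\\0&1&0\end{pmatrix}$, $\mathsf z^{\mathsf T}=(0,0,1)$. $V\in C^\infty(\mathbb R^3)$, $\pi=e^{-\frac{y^2}2-V}$, $b=-aa^{\mathsf T}\nabla V$. $(a^{\mathsf T}\nabla)_1f=\partial_xf+\frac{y^2}2\partial_zf$, $(a^{\mathsf T}\nabla)_2f=\partial_yf$, $(\mathsf z^{\mathsf T}\nabla)_1f=\partial_zf$. Subscripts on $V$ denote partial derivatives. $Lf=\nabla\cdot(aa^{\mathsf T}\nabla f)-\langle a\otimes\nabla a,\nabla f\rangle+\langle b,\nabla f\rangle$ with $(a\otimes\nabla a)_p=\sum_{k=1}^2\sum_{q=1}^3a_{pk}\partial_{x_q}a_{qk}$. $\Gamma_1(f,f)=|a^{\mathsf T}\nabla f|^2$, $\Gamma_1^z(f,f)=|\mathsf z^{\mathsf T}\nabla f|^2$ (extended by polarization), $\Gamma_2(f,f)=\frac12L\Gamma_1(f,f)-\Gamma_1(Lf,f)$,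 and $$\Gamma_2^{z,\pi}(f,f)=\tfrac12L\Gamma_1^z(f,f)-\Gamma_1^z(Lf,f)+\tfrac1\pi\nabla\cdot\big(\pi\,\mathsf z\mathsf z^{\mathsf T}w\big)-\tfrac1\pi\nabla\cdot\big(\pi\,aa^{\mathsf T}\tilde w\big),$$ where $w_p=\langle\nabla f,\partial_{x_p}(aa^{\mathsf T})\nabla f\rangle$, $\tilde w_p=\langle\nabla f,\partial_{x_p}(\mathsf z\mathsf z^{\mathsf T})\nabla f\rangle$, $p=1,2,3$. $X=(f_{11},f_{12},f_{13},f_{21},f_{22},f_{23},f_{31},f_{32},f_{33})^{\mathsf T}$ is the vectorized Hessian, and $$Q=\begin{pmatrix}1&0&\frac{y^2}2&0&0&0&\frac{y^2}2&0&\frac{y^4}4\\0&1&0&0&0&0&0&\frac{y^2}2&0\\0&0&0&1&0&\frac{y^2}2&0&0&0\\0&0&0&0&1&0&0&0&0\end{pmatrix},\qquad P=\begin{pmatrix}0&0&0&0&0&0&1&0&\frac{y^2}2\\0&0&0&0&0&0&0&1&0\end{pmatrix}.$$ *)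

theory Defs
  imports "HOL-Analysis.Analysis"
begin

section \<open>Vector calculus\<close>

text \<open>Over \<open>\<real>\<^sup>n\<close>, \<open>Ck k f\<close> is the usual class \<open>C\<^sup>k\<close>; it is phrased with directional values of the
  Frechet derivative, so that it makes sense over any normed space.\<close>

primrec Ck :: "nat \<Rightarrow> ('a::real_normed_vector \<Rightarrow> 'b::real_normed_vector) \<Rightarrow> bool" where
  "Ck 0 f \<longleftrightarrow> continuous_on UNIV f"
| "Ck (Suc k) f \<longleftrightarrow>
     (\<forall>x. f differentiable (at x)) \<and> (\<forall>v. Ck k (\<lambda>x. frechet_derivative f (at x) v))"

definition smooth :: "('a::real_normed_vector \<Rightarrow> 'b::real_normed_vector) \<Rightarrow> bool" where
  "smooth f \<longleftrightarrow> (\<forall>k. Ck k f)"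

definition partial :: "'n::finite \<Rightarrow> (real^'n \<Rightarrow> 'b::real_normed_vector) \<Rightarrow> real^'n \<Rightarrow> 'b" ("\<partial>")
  where "\<partial> i f x = frechet_derivative f (at x) (axis i 1)"

definition grad :: "(real^'n::finite \<Rightarrow> real) \<Rightarrow> real^'n \<Rightarrow> real^'n" where
  "grad f x = (\<chi> i. \<partial> i f x)"

definition diverg :: "(real^'n::finite \<Rightarrow> real^'n) \<Rightarrow> real^'n \<Rightarrow> real" where
  "diverg F x = (\<Sum>i\<in>UNIV. \<partial> i (\<lambda>u. F u $ i) x)"


section \<open>The Martinet flat structure\<close>

text \<open>A point \<open>p\<close> of \<open>\<real>\<^sup>3\<close> has coordinates \<open>x = p $ 1\<close>, \<open>y = p $ 2\<close>, \<open>z = p $ 3\<close>; in the matrix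
  type \<open>real^'n^'m\<close> the row index is \<open>'m\<close>, so \<open>a_mat\<close> has three rows and two columns and the
  field \<open>(0,0,1)\<close>, here \<open>z_mat\<close>, is a three-row, one-column matrix.\<close>

definition a_mat :: "real^3 \<Rightarrow> real^2^3" where
  "a_mat p = transpose (vector [vector [1, 0, (p $ 2)^2 / 2], vector [0, 1, 0]])"

definition z_mat :: "real^3 \<Rightarrow> real^1^3" where
  "z_mat p = transpose (vector [vector [0, 0, 1]])"

abbreviation aaT :: "real^3 \<Rightarrow> real^3^3" where
  "aaT p \<equiv> a_mat p ** transpose (a_mat p)"

abbreviation zzT :: "real^3 \<Rightarrow> real^3^3" where
  "zzT p \<equiv> z_mat p ** transpose (z_mat p)"

definition a_grad :: "(real^3 \<Rightarrow> real) \<Rightarrow> real^3 \<Rightarrow> real^2" where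
  "a_grad f p = transpose (a_mat p) *v grad f p"

definition z_grad :: "(real^3 \<Rightarrow> real) \<Rightarrow> real^3 \<Rightarrow> real^1" where
  "z_grad f p = transpose (z_mat p) *v grad f p"

definition pi_dens :: "(real^3 \<Rightarrow> real) \<Rightarrow> real^3 \<Rightarrow> real" where
  "pi_dens V p = exp (- ((p $ 2)^2 / 2) - V p)"

definition drift :: "(real^3 \<Rightarrow> real) \<Rightarrow> real^3 \<Rightarrow> real^3" where
  "drift V p = - (aaT p *v grad V p)"

definition a_tensor_grad_a :: "real^3 \<Rightarrow> real^3" where
  "a_tensor_grad_a p =
     (\<chi> i. \<Sum>k\<in>UNIV. \<Sum>q\<in>UNIV. a_mat p $ i $ k * \<partial> q (\<lambda>u. a_mat u $ q $ k) p)"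

definition L_op :: "(real^3 \<Rightarrow> real) \<Rightarrow> (real^3 \<Rightarrow> real) \<Rightarrow> real^3 \<Rightarrow> real" where
  "L_op V f p =
     diverg (\<lambda>u. aaT u *v grad f u) p - a_tensor_grad_a p \<bullet> grad f p + drift V p \<bullet> grad f p"


section \<open>Gamma operators\<close>

text \<open>The inner products are the polarizations of \<open>|a\<^sup>T \<nabla> f|\<^sup>2\<close> and \<open>|z\<^sup>T \<nabla> f|\<^sup>2\<close>.\<close>

definition Gamma1 :: "(real^3 \<Rightarrow> real) \<Rightarrow> (real^3 \<Rightarrow> real) \<Rightarrow> real^3 \<Rightarrow> real" where
  "Gamma1 f g p = a_grad f p \<bullet> a_grad g p"

definition Gamma1z :: "(real^3 \<Rightarrow> real) \<Rightarrow> (real^3 \<Rightarrow> real) \<Rightarrow> real^3 \<Rightarrow> real" where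
  "Gamma1z f g p = z_grad f p \<bullet> z_grad g p"

text \<open>\<open>Gamma2 V f\<close> and \<open>Gamma2z V f\<close> are the diagonal values \<open>\<Gamma>\<^sub>2(f,f)\<close> and
  \<open>\<Gamma>\<^sub>2\<^bsup>z,\<pi>\<^esup>(f,f)\<close>.\<close>

definition Gamma2 :: "(real^3 \<Rightarrow> real) \<Rightarrow> (real^3 \<Rightarrow> real) \<Rightarrow> real^3 \<Rightarrow> real" where
  "Gamma2 V f p = 1/2 * L_op V (Gamma1 f f) p - Gamma1 (L_op V f) f p"

definition grad_form :: "(real^3 \<Rightarrow> real^3^3) \<Rightarrow> (real^3 \<Rightarrow> real) \<Rightarrow> real^3 \<Rightarrow> real^3" where
  "grad_form M f p = (\<chi> i. grad f p \<bullet> (\<partial> i M p *v grad f p))"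

definition Gamma2z :: "(real^3 \<Rightarrow> real) \<Rightarrow> (real^3 \<Rightarrow> real) \<Rightarrow> real^3 \<Rightarrow> real" where
  "Gamma2z V f p =
     1/2 * L_op V (Gamma1z f f) p - Gamma1z (L_op V f) f p
     + 1 / pi_dens V p * diverg (\<lambda>u. pi_dens V u *\<^sub>R (zzT u *v grad_form aaT f u)) p
     - 1 / pi_dens V p * diverg (\<lambda>u. pi_dens V u *\<^sub>R (aaT u *v grad_form zzT f u)) p"


section \<open>The Hessian and curvature terms\<close>

definition Hess_vec :: "(real^3 \<Rightarrow> real) \<Rightarrow> real^3 \<Rightarrow> real^9" where
  "Hess_vec f p = vector
     [\<partial> 1 (\<partial> 1 f) p, \<partial> 1 (\<partial> 2 f) p, \<partial> 1 (\<partial> 3 f) p,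
      \<partial> 2 (\<partial> 1 f) p, \<partial> 2 (\<partial> 2 f) p, \<partial> 2 (\<partial> 3 f) p,
      \<partial> 3 (\<partial> 1 f) p, \<partial> 3 (\<partial> 2 f) p, \<partial> 3 (\<partial> 3 f) p]"

definition Q_mat :: "real^3 \<Rightarrow> real^9^4" where
  "Q_mat p = (let y = p $ 2 in vector
     [vector [1, 0, y^2/2, 0, 0, 0,     y^2/2, 0,     y^4/4],
      vector [0, 1, 0,     0, 0, 0,     0,     y^2/2, 0],
      vector [0, 0, 0,     1, 0, y^2/2, 0,     0,     0],
      vector [0, 0, 0,     0, 1, 0,     0,     0,     0]])"

definition P_mat :: "real^3 \<Rightarrow> real^9^2" where
  "P_mat p = (let y = p $ 2 in vector
     [vector [0, 0, 0, 0, 0, 0, 1, 0, y^2/2],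
      vector [0, 0, 0, 0, 0, 0, 0, 1, 0]])"

definition Lambda1 :: "(real^3 \<Rightarrow> real) \<Rightarrow> real^3 \<Rightarrow> real^9" where
  "Lambda1 f p = (let y = p $ 2 in vector
     [0, y * \<partial> 3 f p / 2, 0, y * \<partial> 3 f p / 2, 0, 0, 0, 0, 0])"

definition Lambda2 :: "(real^3 \<Rightarrow> real) \<Rightarrow> real^3 \<Rightarrow> real^9" where
  "Lambda2 f p = (let y = p $ 2 in vector
     [0, 0, 0, 0, 0, 0, - y * \<partial> 2 f p, y^3 / 2 * \<partial> 3 f p + y * \<partial> 1 f p, 0])"

definition Hess_norm_sq :: "(real^3 \<Rightarrow> real) \<Rightarrow> real^3 \<Rightarrow> real" where
  "Hess_norm_sq f p =
     (Hess_vec f p + Lambda1 f p) \<bullet>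
       ((transpose (Q_mat p) ** Q_mat p) *v (Hess_vec f p + Lambda1 f p))
   + (Hess_vec f p + Lambda2 f p) \<bullet>
       ((transpose (P_mat p) ** P_mat p) *v (Hess_vec f p + Lambda2 f p))"

definition R1 :: "(real^3 \<Rightarrow> real) \<Rightarrow> (real^3 \<Rightarrow> real) \<Rightarrow> real^3 \<Rightarrow> real" where
  "R1 V f p = (let y = p $ 2 in
     y^2 / 2 * Gamma1z f f p - y^2 * Gamma1 f f p + \<partial> 3 f p * a_grad f p $ 1
     + y * a_grad V p $ 1 * \<partial> 3 f p * a_grad f p $ 2
     + y * \<partial> 3 V p * a_grad f p $ 1 * a_grad f p $ 2
     + (\<partial> 1 (\<partial> 1 V) p + y^2 * \<partial> 1 (\<partial> 3 V) p + y^4 / 4 * \<partial> 3 (\<partial> 3 V) p)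
         * \<bar>a_grad f p $ 1\<bar>^2
     + 2 * (\<partial> 1 (\<partial> 2 V) p + y^2 / 2 * \<partial> 2 (\<partial> 3 V) p) * a_grad f p $ 1 * a_grad f p $ 2
     + \<partial> 2 (\<partial> 2 V) p * \<bar>a_grad f p $ 2\<bar>^2
     - y * \<partial> 2 V p * \<partial> 3 f p * a_grad f p $ 1)"

definition R2 :: "(real^3 \<Rightarrow> real) \<Rightarrow> (real^3 \<Rightarrow> real) \<Rightarrow> real^3 \<Rightarrow> real" where
  "R2 V f p = (let y = p $ 2 in
     (\<partial> 1 (\<partial> 3 V) p + y^2 / 2 * \<partial> 3 (\<partial> 3 V) p) * a_grad f p $ 1 * \<partial> 3 f p
     + \<partial> 2 (\<partial> 3 V) p * a_grad f p $ 2 * \<partial> 3 f p)"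

definition curv :: "(real^3 \<Rightarrow> real) \<Rightarrow> (real^3 \<Rightarrow> real) \<Rightarrow> real^3 \<Rightarrow> real" where
  "curv V f p = R1 V f p + R2 V f p"

end

theory Submission
  imports Defs
begin

text \<open>With the frame \<open>X = \<partial>\<^sub>x + y\<^sup>2/2 \<partial>\<^sub>z\<close>, \<open>Y = \<partial>\<^sub>y\<close>, \<open>Z = \<partial>\<^sub>z\<close> one has
  \<open>L = X\<^sup>2 + Y\<^sup>2 - (XV) X - (YV) Y\<close>, \<open>\<Gamma>\<^sub>1(f,f) = (Xf)\<^sup>2 + (Yf)\<^sup>2\<close> and \<open>\<Gamma>\<^sub>1\<^sup>z(f,f) = (Zf)\<^sup>2\<close>.
  Both divergence corrections in \<open>\<Gamma>\<^sub>2\<^sup>z\<^sup>,\<^sup>\<pi>\<close> vanish: \<open>zz\<^sup>T\<close> is constant, and \<open>aa\<^sup>T\<close> depends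
  on \<open>y\<close> only, so that \<open>w\<close> has no \<open>z\<close>-component. Moving all derivatives into the order
  \<open>Y\<close>, \<open>X\<close>, \<open>Z\<close> by means of \<open>[X,Y] = - y Z\<close> and \<open>[X,Z] = [Y,Z] = 0\<close> cancels the third-order
  terms; what remains is a polynomial identity between derivatives of order at most two.\<close>

section \<open>Smooth functions\<close>

text \<open>Differentiability gives continuity at the bottom level; above it the claim passes to the
  directional derivatives, which is why \<open>f\<close> varies in the induction.\<close>

lemma Ck_SucD: "Ck (Suc k) f \<Longrightarrow> Ck k f"
proof (induction k arbitrary: f)
  case 0
  then show ?case
    by (auto simp: continuous_on_eq_continuous_at differentiable_imp_continuous_within)
next
  case (Suc k)
  then show ?case by (simp only: Ck.simps(2)) blast
qed

lemma Ck_const: "Ck k (\<lambda>x. c)"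
  by (induction k arbitrary: c) auto

lemma Ck_bounded_linear: "bounded_linear f \<Longrightarrow> Ck k f"
proof (cases k)
  case 0
  then show "bounded_linear f \<Longrightarrow> Ck k f"
    by (simp add: linear_continuous_on)
next
  case (Suc m)
  assume f: "bounded_linear f"
  have "frechet_derivative f (at x) = f" for x
    using f bounded_linear_imp_has_derivative frechet_derivative_at by metis
  then show ?thesis
    using Suc f by (simp add: bounded_linear_imp_differentiable Ck_const)
qed

lemma Ck_add:
  assumes "Ck k f" "Ck k g"
  shows "Ck k (\<lambda>x. f x + g x)"
  using assms
proof (induction k arbitrary: f g)
  case (Suc k)
  have "frechet_derivative (\<lambda>x. f x + g x) (at x)
      = (\<lambda>v. frechet_derivative f (at x) v + frechet_derivative g (at x) v)" for x
    using Suc.prems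
    by (intro frechet_derivative_at[symmetric] derivative_intros) (auto simp: frechet_derivative_works)
  then show ?case
    using Suc by auto
qed (auto intro: continuous_intros)

lemma Ck_mult:
  fixes f g :: "'a::real_normed_vector \<Rightarrow> 'b::real_normed_algebra"
  assumes "Ck k f" "Ck k g"
  shows "Ck k (\<lambda>x. f x * g x)"
  using assms
proof (induction k arbitrary: f g)
  case (Suc k)
  have *: "frechet_derivative (\<lambda>x. f x * g x) (at x)
      = (\<lambda>v. f x * frechet_derivative g (at x) v + frechet_derivative f (at x) v * g x)" for x
    using Suc.prems
    by (intro frechet_derivative_at[symmetric] has_derivative_mult)
       (auto simp: frechet_derivative_works)
  \<comment> \<open>The product rule contains the undifferentiated factors, so they are needed in
    the lower class as well.\<close>
  have "Ck k f" "Ck k g"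
    using Suc.prems Ck_SucD by blast+
  then show ?case
    using Suc by (auto simp: * intro!: Ck_add)
qed (auto intro: continuous_intros)

lemma smooth_const [simp]: "smooth (\<lambda>x. c)"
  by (simp add: smooth_def Ck_const)

lemma smooth_add [simp]: "smooth f \<Longrightarrow> smooth g \<Longrightarrow> smooth (\<lambda>x. f x + g x)"
  by (simp add: smooth_def Ck_add)

lemma smooth_mult [simp]:
  fixes f g :: "'a::real_normed_vector \<Rightarrow> 'b::real_normed_algebra"
  shows "smooth f \<Longrightarrow> smooth g \<Longrightarrow> smooth (\<lambda>x. f x * g x)"
  by (simp add: smooth_def Ck_mult)

lemma smooth_minus [simp]:
  fixes f :: "'a::real_normed_vector \<Rightarrow> 'b::real_normed_algebra_1"
  shows "smooth f \<Longrightarrow> smooth (\<lambda>x. - f x)"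
  using smooth_mult[of "\<lambda>x. - 1" f] by simp

lemma smooth_diff [simp]:
  fixes f g :: "'a::real_normed_vector \<Rightarrow> 'b::real_normed_algebra_1"
  shows "smooth f \<Longrightarrow> smooth g \<Longrightarrow> smooth (\<lambda>x. f x - g x)"
  using smooth_add[of f "\<lambda>x. - g x"] by simp

lemma smooth_divide_const [simp]:
  fixes f :: "'a::real_normed_vector \<Rightarrow> 'b::real_normed_field"
  shows "smooth f \<Longrightarrow> smooth (\<lambda>x. f x / c)"
  using smooth_mult[of f "\<lambda>x. inverse c"] by (simp add: divide_inverse)

lemma smooth_nth [simp]: "smooth (\<lambda>p::real^'n. p $ i)"
  by (simp add: smooth_def Ck_bounded_linear bounded_linear_vec_nth)

lemma smooth_differentiable: "smooth f \<Longrightarrow> f differentiable (at x)"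
  unfolding smooth_def by (metis Ck.simps(2))

lemma smooth_frechet_derivative:
  "smooth f \<Longrightarrow> smooth (\<lambda>x. frechet_derivative f (at x) v)"
  unfolding smooth_def by (metis Ck.simps(2))

lemma smooth_partial [simp]: "smooth f \<Longrightarrow> smooth (\<partial> i f)"
  using smooth_frechet_derivative by (simp add: partial_def[abs_def])


section \<open>Symmetry of second derivatives\<close>

text \<open>The mean value theorem is used twice, first along \<open>u\<close>, then along
  \<open>v\<close>. The second difference on the left is symmetric in \<open>u\<close> and
  \<open>v\<close>, while the right side fixes an order of differentiation.\<close>

lemma second_difference_mean_value:
  fixes f :: "'a::real_normed_vector \<Rightarrow> real"
  assumes f: "\<And>x. f differentiable (at x)"
    and f': "\<And>x. (\<lambda>y. frechet_derivative f (at y) u) differentiable (at x)"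
    and h: "h > 0"
  obtains q where "dist q p \<le> h * (norm u + norm v)"
    and "f (p + h *\<^sub>R u + h *\<^sub>R v) - f (p + h *\<^sub>R u) - f (p + h *\<^sub>R v) + f p
      = h^2 * frechet_derivative (\<lambda>y. frechet_derivative f (at y) u) (at q) v"
proof -
  \<comment> \<open>The chain rule along a line reduces both applications to functions of one real
    variable.\<close>
  have line: "((\<lambda>s. g (a + s *\<^sub>R w)) has_real_derivative frechet_derivative g (at (a + s *\<^sub>R w)) w) (at s)"
    if "\<And>x. g differentiable (at x)" for g :: "'a \<Rightarrow> real" and a w s
  proof -
    have "((\<lambda>s. a + s *\<^sub>R w) has_derivative (\<lambda>t. t *\<^sub>R w)) (at s)"
      by (auto intro!: derivative_eq_intros)
    moreover have "(g has_derivative frechet_derivative g (at (a + s *\<^sub>R w))) (at (a + s *\<^sub>R w))"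
      using that frechet_derivative_works by blast
    ultimately have "((\<lambda>s. g (a + s *\<^sub>R w)) has_derivative
        (\<lambda>t. frechet_derivative g (at (a + s *\<^sub>R w)) (t *\<^sub>R w))) (at s)"
      by (rule has_derivative_compose)
    moreover have "frechet_derivative g (at (a + s *\<^sub>R w)) (t *\<^sub>R w)
        = frechet_derivative g (at (a + s *\<^sub>R w)) w * t" for t
      using linear_cmul[OF linear_frechet_derivative[OF that]] by simp
    ultimately show ?thesis
      by (simp add: has_field_derivative_def)
  qed
  define D where "D = (\<lambda>y. frechet_derivative f (at y) u)"
  \<comment> \<open>Taking the increment over \<open>h v\<close> as one function of the step along
    \<open>u\<close> makes a single \<xi> serve both terms, leaving a first difference of
    \<open>D\<close>.\<close>
  obtain \<xi> where \<xi>: "0 < \<xi>" "\<xi> < h"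
    and 1: "(f ((p + h *\<^sub>R v) + h *\<^sub>R u) - f (p + h *\<^sub>R u)) - (f ((p + h *\<^sub>R v) + 0 *\<^sub>R u) - f (p + 0 *\<^sub>R u))
      = (h - 0) * (D ((p + h *\<^sub>R v) + \<xi> *\<^sub>R u) - D (p + \<xi> *\<^sub>R u))"
    using MVT2[OF h, of "\<lambda>s. f ((p + h *\<^sub>R v) + s *\<^sub>R u) - f (p + s *\<^sub>R u)"
        "\<lambda>s. D ((p + h *\<^sub>R v) + s *\<^sub>R u) - D (p + s *\<^sub>R u)"]
      DERIV_diff[OF line line] f unfolding D_def by blast
  obtain \<eta> where \<eta>: "0 < \<eta>" "\<eta> < h"
    and 2: "D ((p + \<xi> *\<^sub>R u) + h *\<^sub>R v) - D ((p + \<xi> *\<^sub>R u) + 0 *\<^sub>R v)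
      = (h - 0) * frechet_derivative D (at ((p + \<xi> *\<^sub>R u) + \<eta> *\<^sub>R v)) v"
    using MVT2[OF h, of "\<lambda>s. D ((p + \<xi> *\<^sub>R u) + s *\<^sub>R v)"
        "\<lambda>s. frechet_derivative D (at ((p + \<xi> *\<^sub>R u) + s *\<^sub>R v)) v"]
      line[of D] f' unfolding D_def by blast
  show thesis
  proof (rule that)
    have "dist ((p + \<xi> *\<^sub>R u) + \<eta> *\<^sub>R v) p = norm (\<xi> *\<^sub>R u + \<eta> *\<^sub>R v)"
      by (simp add: dist_norm add.assoc)
    also have "\<dots> \<le> \<xi> * norm u + \<eta> * norm v"
      using norm_triangle_ineq[of "\<xi> *\<^sub>R u" "\<eta> *\<^sub>R v"] \<xi> \<eta> by simp
    also have "\<dots> \<le> h * norm u + h * norm v"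
      using \<xi> \<eta> by (intro add_mono mult_right_mono) auto
    finally show "dist ((p + \<xi> *\<^sub>R u) + \<eta> *\<^sub>R v) p \<le> h * (norm u + norm v)"
      by (simp add: distrib_left)
    show "f (p + h *\<^sub>R u + h *\<^sub>R v) - f (p + h *\<^sub>R u) - f (p + h *\<^sub>R v) + f p
      = h^2 * frechet_derivative (\<lambda>y. frechet_derivative f (at y) u) (at ((p + \<xi> *\<^sub>R u) + \<eta> *\<^sub>R v)) v"
      using 1 2 unfolding D_def by (simp add: power2_eq_square ac_simps)
  qed
qed

text \<open>Divided by the squared step, the same second difference tends to either mixed
  derivative, by continuity of the second derivatives; limits are unique.\<close>

lemma frechet_derivative_commute:
  fixes f :: "'a::real_normed_vector \<Rightarrow> real"
  assumes "Ck 2 f"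
  shows "frechet_derivative (\<lambda>y. frechet_derivative f (at y) u) (at p) v
       = frechet_derivative (\<lambda>y. frechet_derivative f (at y) v) (at p) u"
proof -
  define D where "D = (\<lambda>u v q. frechet_derivative (\<lambda>y. frechet_derivative f (at y) u) (at q) v)"
  have f: "f differentiable (at x)" 
    and f': "(\<lambda>y. frechet_derivative f (at y) w) differentiable (at x)"
    and cont: "isCont (D w w') x" for x w w'
    using assms by (auto simp: numeral_2_eq_2 D_def continuous_on_eq_continuous_at)
  define h where "h = (\<lambda>n. inverse (real (Suc n)))"
  have h: "h n > 0" for n by (simp add: h_def)
  have h0: "h \<longlonglongrightarrow> 0"
    unfolding h_def by (rule LIMSEQ_inverse_real_of_nat)
  define S where "S = (\<lambda>n. f (p + h n *\<^sub>R u + h n *\<^sub>R v) - f (p + h n *\<^sub>R u) - f (p + h n *\<^sub>R v) + f p)"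
  \<comment> \<open>\<open>S\<close> stays fixed while \<open>w\<close>, \<open>w'\<close> vary, so
    that the claim covers both (\<open>u\<close>, \<open>v\<close>) and (\<open>v\<close>,
    \<open>u\<close>).\<close>
  have lim: "(\<lambda>n. S n / (h n)^2) \<longlonglongrightarrow> D w w' p"
    if S: "\<And>n. S n = f (p + h n *\<^sub>R w + h n *\<^sub>R w') - f (p + h n *\<^sub>R w) - f (p + h n *\<^sub>R w') + f p"
    for w w'
  proof -
    have "\<exists>q. dist q p \<le> h n * (norm w + norm w') \<and> S n = (h n)^2 * D w w' q" for n
      using second_difference_mean_value[OF f f' h[of n], of p w w'] unfolding S D_def by metis
    then obtain q where q: "\<And>n. dist (q n) p \<le> h n * (norm w + norm w')"
      and Sq: "\<And>n. S n = (h n)^2 * D w w' (q n)"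
      by metis
    have "(\<lambda>n. h n * (norm w + norm w')) \<longlonglongrightarrow> 0"
      using tendsto_mult_left_zero[OF h0] .
    then have "(\<lambda>n. dist (q n) p) \<longlonglongrightarrow> 0"
      by (rule tendsto_sandwich[OF _ _ tendsto_const, rotated 2]) (use q in auto)
    then have "q \<longlonglongrightarrow> p"
      by (simp add: tendsto_dist_iff[symmetric])
    then have "(\<lambda>n. D w w' (q n)) \<longlonglongrightarrow> D w w' p"
      using cont isCont_tendsto_compose by blast
    moreover have "S n / (h n)^2 = D w w' (q n)" for n
      using Sq[of n] h[of n] by simp
    ultimately show ?thesis by simp
  qed
  have "D u v p = D v u p"
    by (rule LIMSEQ_unique[OF lim lim]) (simp_all add: S_def ac_simps)
  then show ?thesis
    by (simp add: D_def)
qed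

lemma partial_commute:
  fixes f :: "real^'n \<Rightarrow> real"
  assumes "smooth f"
  shows "\<partial> i (\<partial> j f) = \<partial> j (\<partial> i f)"
  using frechet_derivative_commute[of f] assms
  by (auto simp: partial_def[abs_def] smooth_def)


section \<open>Rules for partial derivatives\<close>

lemma partial_const [simp]: "\<partial> i (\<lambda>x. c) = (\<lambda>x. 0)"
  by (simp add: partial_def[abs_def])

lemma partial_nth [simp]: "\<partial> i (\<lambda>x::real^'n. x $ j) = (\<lambda>x. if i = j then 1 else 0)"
proof
  fix x :: "real^'n"
  have "frechet_derivative (\<lambda>x::real^'n. x $ j) (at x) = (\<lambda>x. x $ j)"
    by (rule frechet_derivative_at[symmetric])
       (simp add: bounded_linear_imp_has_derivative bounded_linear_vec_nth)
  then show "\<partial> i (\<lambda>x::real^'n. x $ j) x = (if i = j then 1 else 0)"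
    by (simp add: partial_def axis_def)
qed

text \<open>Meant for matrix fields such as \<open>aaT\<close> that depend on a single coordinate;
  hence the general codomain of \<open>g\<close>.\<close>

lemma partial_comp_nth:
  fixes p :: "real^'n"
  assumes "g differentiable (at (p $ j))" "i \<noteq> j"
  shows "\<partial> i (\<lambda>u. g (u $ j)) p = 0"
proof -
  have "((\<lambda>u::real^'n. u $ j) has_derivative (\<lambda>u. u $ j)) (at p)"
    by (simp add: bounded_linear_imp_has_derivative bounded_linear_vec_nth)
  moreover have g: "(g has_derivative frechet_derivative g (at (p $ j))) (at (p $ j))"
    using assms(1) frechet_derivative_works by blast
  ultimately have "((\<lambda>u. g (u $ j)) has_derivative (\<lambda>u. frechet_derivative g (at (p $ j)) (u $ j))) (at p)"
    by (rule has_derivative_compose)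
  then have "\<partial> i (\<lambda>u. g (u $ j)) p = frechet_derivative g (at (p $ j)) (axis i 1 $ j)"
    unfolding partial_def by (metis frechet_derivative_at)
  also have "\<dots> = 0"
    using assms(2) linear_0[OF has_derivative_linear[OF g]] by (simp add: axis_def)
  finally show ?thesis .
qed

text \<open>This and the following rules equate functions rather than values, so that rewriting
  reaches iterated partial derivatives.\<close>

lemma partial_add [simp]:
  assumes "smooth f" "smooth g"
  shows "\<partial> i (\<lambda>x. f x + g x) = (\<lambda>x. \<partial> i f x + \<partial> i g x)"
proof
  fix x
  have "frechet_derivative (\<lambda>x. f x + g x) (at x)
      = (\<lambda>v. frechet_derivative f (at x) v + frechet_derivative g (at x) v)"
    using smooth_differentiable assms
    by (intro frechet_derivative_at[symmetric] derivative_intros) (auto simp: frechet_derivative_works)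
  then show "\<partial> i (\<lambda>x. f x + g x) x = \<partial> i f x + \<partial> i g x"
    by (simp add: partial_def)
qed

lemma partial_mult [simp]:
  fixes f g :: "real^'n \<Rightarrow> 'b::real_normed_algebra"
  assumes "smooth f" "smooth g"
  shows "\<partial> i (\<lambda>x. f x * g x) = (\<lambda>x. f x * \<partial> i g x + \<partial> i f x * g x)"
proof
  fix x
  have "frechet_derivative (\<lambda>x. f x * g x) (at x)
      = (\<lambda>v. f x * frechet_derivative g (at x) v + frechet_derivative f (at x) v * g x)"
    using smooth_differentiable assms
    by (intro frechet_derivative_at[symmetric] has_derivative_mult)
       (auto simp: frechet_derivative_works)
  then show "\<partial> i (\<lambda>x. f x * g x) x = f x * \<partial> i g x + \<partial> i f x * g x"
    by (simp add: partial_def)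
qed

lemma partial_minus [simp]:
  fixes f :: "real^'n \<Rightarrow> 'b::real_normed_algebra_1"
  assumes "smooth f"
  shows "\<partial> i (\<lambda>x. - f x) = (\<lambda>x. - \<partial> i f x)"
  using partial_mult[of "\<lambda>x. - 1" f i] assms by simp

lemma partial_diff [simp]:
  fixes f g :: "real^'n \<Rightarrow> 'b::real_normed_algebra_1"
  assumes "smooth f" "smooth g"
  shows "\<partial> i (\<lambda>x. f x - g x) = (\<lambda>x. \<partial> i f x - \<partial> i g x)"
  using partial_add[of f "\<lambda>x. - g x" i] assms by simp

lemma partial_divide_const [simp]:
  fixes f :: "real^'n \<Rightarrow> 'b::real_normed_field"
  assumes "smooth f"
  shows "\<partial> i (\<lambda>x. f x / c) = (\<lambda>x. \<partial> i f x / c)"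
  using partial_mult[of f "\<lambda>x. inverse c" i] assms by (simp add: divide_inverse)


section \<open>The Martinet frame\<close>

text \<open>The square is written as a product because the rules above differentiate products, not
  powers.\<close>

definition X_field :: "(real^3 \<Rightarrow> real) \<Rightarrow> real^3 \<Rightarrow> real" where
  "X_field f = (\<lambda>p. \<partial> 1 f p + p $ 2 * p $ 2 / 2 * \<partial> 3 f p)"

lemma smooth_X_field [simp]: "smooth f \<Longrightarrow> smooth (X_field f)"
  by (simp add: X_field_def)

lemma X_field_const [simp]: "X_field (\<lambda>p. c) = (\<lambda>p. 0)"
  by (simp add: X_field_def)

lemma X_field_y [simp]: "X_field (\<lambda>p. p $ 2) = (\<lambda>p. 0)"
  by (simp add: X_field_def)

lemma X_field_add [simp]:
  "smooth f \<Longrightarrow> smooth g \<Longrightarrow> X_field (\<lambda>p. f p + g p) = (\<lambda>p. X_field f p + X_field g p)"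
  by (rule ext) (simp add: X_field_def field_simps)

lemma X_field_diff [simp]:
  "smooth f \<Longrightarrow> smooth g \<Longrightarrow> X_field (\<lambda>p. f p - g p) = (\<lambda>p. X_field f p - X_field g p)"
  by (rule ext) (simp add: X_field_def field_simps)

lemma X_field_mult [simp]:
  "smooth f \<Longrightarrow> smooth g \<Longrightarrow>
    X_field (\<lambda>p. f p * g p) = (\<lambda>p. f p * X_field g p + X_field f p * g p)"
  by (rule ext) (simp add: X_field_def field_simps)

text \<open>The bracket relation \<open>[X,Y] = - y Z\<close>: the extra term arises when
  \<open>Y\<close> differentiates the coefficient of \<open>X\<close>.\<close>

lemma X_field_partial_2:
  "smooth f \<Longrightarrow> X_field (\<partial> 2 f) = (\<lambda>p. \<partial> 2 (X_field f) p - p $ 2 * \<partial> 3 f p)"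
  by (rule ext, simp add: X_field_def partial_commute[of f 2]) (simp add: algebra_simps)

lemma partial_3_X_field: "smooth f \<Longrightarrow> \<partial> 3 (X_field f) = X_field (\<partial> 3 f)"
  by (simp add: X_field_def partial_commute[of f 3 1])

lemma partial_3_partial_2: "smooth f \<Longrightarrow> \<partial> 3 (\<partial> 2 f) = \<partial> 2 (\<partial> 3 f)"
  for f :: "real^3 \<Rightarrow> real"
  by (rule partial_commute)

text \<open>As left-to-right rewriting these lead to a normal form with \<open>\<partial> 2\<close>
  outermost and \<open>\<partial> 3\<close> innermost.\<close>

lemmas frame_commute = X_field_partial_2 partial_3_X_field partial_3_partial_2

text \<open>No first-order term appears, since \<open>X\<close> annihilates its own coefficient, a
  function of y alone.\<close>

lemma X_field_X_field:
  assumes "smooth f"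
  shows "X_field (X_field f) p
    = \<partial> 1 (\<partial> 1 f) p + (p $ 2)^2 * \<partial> 1 (\<partial> 3 f) p + (p $ 2)^4 / 4 * \<partial> 3 (\<partial> 3 f) p"
  using assms
  by (simp add: X_field_def partial_commute[of f 3 1])
    (simp add: field_simps eval_nat_numeral)


section \<open>The operators in the Martinet frame\<close>

lemma a_grad_nth: "a_grad f p $ 1 = X_field f p" "a_grad f p $ 2 = \<partial> 2 f p"
  by (simp_all add: a_grad_def X_field_def a_mat_def grad_def matrix_vector_mult_def sum_3 power2_eq_square)

lemma z_grad_nth: "z_grad f p $ 1 = \<partial> 3 f p"
  by (simp add: z_grad_def z_mat_def grad_def matrix_vector_mult_def sum_3)

text \<open>An equality of functions, since \<open>L_op\<close> differentiates the result.\<close>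

lemma Gamma1_eq: "Gamma1 f g = (\<lambda>p. X_field f p * X_field g p + \<partial> 2 f p * \<partial> 2 g p)"
  by (simp add: fun_eq_iff Gamma1_def inner_vec_def sum_2 a_grad_nth)

lemma Gamma1z_eq: "Gamma1z f g = (\<lambda>p. \<partial> 3 f p * \<partial> 3 g p)"
  by (simp add: fun_eq_iff Gamma1z_def inner_vec_def z_grad_nth)

lemma a_mat_nth:
  "a_mat p $ 1 $ 1 = 1" "a_mat p $ 1 $ 2 = 0" "a_mat p $ 2 $ 1 = 0" "a_mat p $ 2 $ 2 = 1"
  "a_mat p $ 3 $ 1 = p $ 2 * p $ 2 / 2" "a_mat p $ 3 $ 2 = 0"
  by (simp_all add: a_mat_def transpose_def power2_eq_square)

lemma aaT_eq:
  "aaT p = vector [vector [1, 0, p $ 2 * p $ 2 / 2], vector [0, 1, 0],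
     vector [p $ 2 * p $ 2 / 2, 0, (p $ 2 * p $ 2 / 2) * (p $ 2 * p $ 2 / 2)]]"
  by (simp add: vec_eq_iff forall_3 matrix_matrix_mult_def transpose_def sum_2 a_mat_nth)

text \<open>Displays the matrix as a function of y alone, in the shape
  \<open>partial_comp_nth\<close> expects. The -1 offsets the last diagonal entry of
  \<open>mat 1\<close>.\<close>

lemma aaT_eq_poly:
  "aaT p = mat 1
     + ((p $ 2)^2 / 2) *\<^sub>R vector [vector [0, 0, 1], vector [0, 0, 0], vector [1, 0, 0]]
     + ((p $ 2)^4 / 4 - 1) *\<^sub>R vector [vector [0, 0, 0], vector [0, 0, 0], vector [0, 0, 1]]"
  by (simp add: aaT_eq vec_eq_iff forall_3 mat_def eval_nat_numeral)

text \<open>The columns of \<open>a_mat\<close> are divergence free: the only nonconstant entry sits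
  in row 3 and depends on y, not on z.\<close>

lemma a_tensor_grad_a_eq_0: "a_tensor_grad_a p = 0"
  by (simp add: vec_eq_iff forall_3 a_tensor_grad_a_def sum_2 sum_3 a_mat_nth)

lemma L_op_eq:
  assumes "smooth V" "smooth f"
  shows "L_op V f = (\<lambda>p. X_field (X_field f) p + \<partial> 2 (\<partial> 2 f) p
    - X_field V p * X_field f p - \<partial> 2 V p * \<partial> 2 f p)"
proof
  fix p
  have "diverg (\<lambda>u. aaT u *v grad f u) p = X_field (X_field f) p + \<partial> 2 (\<partial> 2 f) p"
    using assms
    by (simp add: diverg_def aaT_eq matrix_vector_mult_def sum_3 grad_def X_field_def)
      (simp add: field_simps)
  moreover have "drift V p \<bullet> grad f p = - X_field V p * X_field f p - \<partial> 2 V p * \<partial> 2 f p"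
    by (simp add: drift_def aaT_eq matrix_vector_mult_def sum_3 grad_def X_field_def inner_vec_def)
      (simp add: field_simps)
  ultimately show "L_op V f p = X_field (X_field f) p + \<partial> 2 (\<partial> 2 f) p
    - X_field V p * X_field f p - \<partial> 2 V p * \<partial> 2 f p"
    by (simp add: L_op_def a_tensor_grad_a_eq_0)
qed

lemma Gamma2z_eq:
  assumes "smooth V" "smooth f"
  shows "Gamma2z V f p = 1/2 * L_op V (Gamma1z f f) p - Gamma1z (L_op V f) f p"
proof -
  have zzT: "zzT u = (\<chi> i j. if i = 3 \<and> j = 3 then 1 else 0)" for u
    by (simp add: vec_eq_iff forall_3 matrix_matrix_mult_def transpose_def z_mat_def)
  have "\<partial> i zzT = (\<lambda>u. 0)" for i
    unfolding zzT by (rule partial_const)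
  then have "grad_form zzT f u = 0" for u
    by (simp add: grad_form_def vec_eq_iff)
  \<comment> \<open>\<open>zzT\<close> keeps only the third component, which involves the
    z-derivative of \<open>aaT\<close>.\<close>
  moreover have "zzT u *v grad_form aaT f u = 0" for u
  proof -
    have "\<partial> 3 aaT u = 0"
      unfolding aaT_eq_poly by (rule partial_comp_nth) (auto intro!: derivative_intros)
    then have "grad_form aaT f u $ 3 = 0"
      by (simp add: grad_form_def)
    then show ?thesis
      by (simp add: zzT vec_eq_iff forall_3 matrix_vector_mult_def sum_3)
  qed
  ultimately show ?thesis
    by (simp add: Gamma2z_def diverg_def)
qed

section \<open>Nine-dimensional coordinates and the Hessian norm\<close>

lemma exhaust_9: "(i::9) \<in> {1, 2, 3, 4, 5, 6, 7, 8, 9}"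
proof (induct i)
  case (of_int z)
  \<comment> \<open>Elements of the type are residues modulo 9; the residue 0 is the numeral
    9.\<close>
  then have "z \<in> {0, 1, 2, 3, 4, 5, 6, 7, 8}" by fastforce
  then show ?case by auto
qed

lemma UNIV_9: "(UNIV::9 set) = {1, 2, 3, 4, 5, 6, 7, 8, 9}"
  using exhaust_9 by blast

lemma sum_9: "sum f (UNIV::9 set) = f 1 + f 2 + f 3 + f 4 + f 5 + f 6 + f 7 + f 8 + f 9"
  unfolding UNIV_9 by (simp add: add.assoc)

lemma vector_9 [simp]:
  "(vector [x1,x2,x3,x4,x5,x6,x7,x8,x9] :: ('a::zero)^9) $ 1 = x1"
  "(vector [x1,x2,x3,x4,x5,x6,x7,x8,x9] :: ('a::zero)^9) $ 2 = x2"
  "(vector [x1,x2,x3,x4,x5,x6,x7,x8,x9] :: ('a::zero)^9) $ 3 = x3"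
  "(vector [x1,x2,x3,x4,x5,x6,x7,x8,x9] :: ('a::zero)^9) $ 4 = x4"
  "(vector [x1,x2,x3,x4,x5,x6,x7,x8,x9] :: ('a::zero)^9) $ 5 = x5"
  "(vector [x1,x2,x3,x4,x5,x6,x7,x8,x9] :: ('a::zero)^9) $ 6 = x6"
  "(vector [x1,x2,x3,x4,x5,x6,x7,x8,x9] :: ('a::zero)^9) $ 7 = x7"
  "(vector [x1,x2,x3,x4,x5,x6,x7,x8,x9] :: ('a::zero)^9) $ 8 = x8"
  "(vector [x1,x2,x3,x4,x5,x6,x7,x8,x9] :: ('a::zero)^9) $ 9 = x9"
  unfolding vector_def by simp_all

lemma vector_4 [simp]:
  "(vector [x1,x2,x3,x4] :: ('a::zero)^4) $ 1 = x1"
  "(vector [x1,x2,x3,x4] :: ('a::zero)^4) $ 2 = x2"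
  "(vector [x1,x2,x3,x4] :: ('a::zero)^4) $ 3 = x3"
  "(vector [x1,x2,x3,x4] :: ('a::zero)^4) $ 4 = x4"
  unfolding vector_def by simp_all

text \<open>Only the rows of \<open>Q_mat\<close> and \<open>P_mat\<close> then have to be
  evaluated, not the 9 by 9 products.\<close>

lemma inner_transpose_matrix_mult:
  fixes A :: "real^'n^'m"
  shows "x \<bullet> ((transpose A ** A) *v x) = (A *v x) \<bullet> (A *v x)"
  by (metis dot_lmul_matrix matrix_vector_mul_assoc transpose_matrix_vector transpose_transpose)

text \<open>Rows 2 and 3 of \<open>Q_mat\<close> turn the Hessian into \<open>XYf\<close> and
  \<open>YXf - y Zf\<close>, which agree by the bracket relation. Adding \<open>y Zf / 2\<close>
  from \<open>Lambda1\<close> makes each the symmetrized \<open>(XYf + YXf) / 2\<close>, whence the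
  factor 2.\<close>

lemma Hess_norm_sq_eq:
  assumes "smooth f"
  shows "Hess_norm_sq f p = (X_field (X_field f) p)^2
    + (\<partial> 2 (X_field f) p - p $ 2 / 2 * \<partial> 3 f p)^2 * 2
    + (\<partial> 2 (\<partial> 2 f) p)^2
    + (X_field (\<partial> 3 f) p - p $ 2 * \<partial> 2 f p)^2
    + (\<partial> 2 (\<partial> 3 f) p + p $ 2 * X_field f p)^2"
proof -
  define y where "y = p $ 2"
  define v where "v = Hess_vec f p + Lambda1 f p"
  have Q: "(Q_mat p *v v) $ 1 = X_field (X_field f) p"
    "(Q_mat p *v v) $ 2 = \<partial> 2 (X_field f) p - y / 2 * \<partial> 3 f p"
    "(Q_mat p *v v) $ 3 = \<partial> 2 (X_field f) p - y / 2 * \<partial> 3 f p"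
    "(Q_mat p *v v) $ 4 = \<partial> 2 (\<partial> 2 f) p"
    unfolding X_field_X_field[OF assms]
    using assms
    by (simp_all add: v_def y_def Q_mat_def Let_def matrix_vector_mult_def sum_9 Hess_vec_def Lambda1_def
        X_field_def partial_commute[of f 2 1] partial_commute[of f 3 1] partial_commute[of f 3 2])
      (simp_all add: field_simps power2_eq_square)
  define w where "w = Hess_vec f p + Lambda2 f p"
  have P: "(P_mat p *v w) $ 1 = X_field (\<partial> 3 f) p - y * \<partial> 2 f p"
    "(P_mat p *v w) $ 2 = \<partial> 2 (\<partial> 3 f) p + y * X_field f p"
    using assms
    by (simp_all add: w_def y_def P_mat_def Let_def matrix_vector_mult_def sum_9 Hess_vec_def Lambda2_def
        X_field_def partial_commute[of f 3 1] partial_commute[of f 3 2])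
      (simp_all add: field_simps eval_nat_numeral)
  show ?thesis
    unfolding Hess_norm_sq_def inner_transpose_matrix_mult v_def[symmetric] w_def[symmetric]
      y_def[symmetric]
    by (simp add: inner_vec_def sum_2 sum_4 Q P power2_eq_square)
qed

theorem proposition3p18:
  fixes V f :: "real^3 \<Rightarrow> real"
  assumes "smooth V" and "smooth f"
  shows "\<forall>p. Gamma2 V f p + Gamma2z V f p = Hess_norm_sq f p + curv V f p"
proof
  fix p
  \<comment> \<open>The groups of second derivatives of \<open>V\<close> in the curvature are
    \<open>XXV\<close>, \<open>XYV\<close> and \<open>XZV\<close>, the second one rewritten with
    \<open>Y\<close> outermost.\<close>
  have V2: "\<partial> 1 (\<partial> 1 V) p + (p $ 2)^2 * \<partial> 1 (\<partial> 3 V) p + (p $ 2)^4 / 4 * \<partial> 3 (\<partial> 3 V) p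
      = X_field (X_field V) p"
    "\<partial> 1 (\<partial> 2 V) p + (p $ 2)^2 / 2 * \<partial> 2 (\<partial> 3 V) p
      = \<partial> 2 (X_field V) p - p $ 2 * \<partial> 3 V p"
    "\<partial> 1 (\<partial> 3 V) p + (p $ 2)^2 / 2 * \<partial> 3 (\<partial> 3 V) p = X_field (\<partial> 3 V) p"
    using assms
    by (simp_all only: X_field_X_field)
      (simp_all add: X_field_def partial_commute[of V 2 1] partial_commute[of V 3 1]
        partial_commute[of V 3 2] field_simps power2_eq_square)
  show "Gamma2 V f p + Gamma2z V f p = Hess_norm_sq f p + curv V f p"
    unfolding curv_def R1_def R2_def Let_def a_grad_nth V2 Hess_norm_sq_eq[OF assms(2)]
      Gamma2z_eq[OF assms] Gamma2_def
    using assms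
    \<comment> \<open>This call differentiates and sorts the frame derivatives; the next one checks
      the resulting polynomial identity.\<close>
    by (simp add: Gamma1_eq Gamma1z_eq L_op_eq frame_commute)
      (simp add: field_simps power2_eq_square)
qed

end
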